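(* Let $n\ge 1$, let $X\subset\mathbb{R}^{2}$ be a connected neighborhood of $0$, and let $u\in C^{\infty}(X,\mathbb{C}^{n})$ be such that, for some constant $C>0$, $$|\Delta u|\leq C\left(|u|+|\partial_{x_{1}}u|+|\partial_{x_{2}}u|\right)\quad\text{in } X.$$ If $u$ vanishes to infinite order at $0$, then $u=0$ in $X$.
   Context: Here $x=(x_1,x_2)$ are the standard coordinates on $\mathbb{R}^2$ and $\Delta=\partial_{x_{1}}^{2}+\partial_{x_{2}}^{2}$ is the standard Laplacian, acting componentwise on $\mathbb{C}^n$-valued functions. Neighborhoods are understood to be open. A smooth function $u$ vanishes to infinite order at $0$ if for every $N$ there exists a constant $C_N$ such that $|u(x)|\le C_N|x|^N$ in a neighborhood of $0$. *)

theory Defs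
  imports "HOL-Analysis.Analysis"
begin

definition partial_deriv ::
    "'m::finite \<Rightarrow> (real ^ 'm \<Rightarrow> 'b::real_normed_vector) \<Rightarrow> real ^ 'm \<Rightarrow> 'b"
  where "partial_deriv i f x = vector_derivative (\<lambda>t. f (x + t *\<^sub>R axis i 1)) (at 0)"

text \<open>The index type of \<open>real ^ 2\<close> is the two-element type \<open>2\<close>, whose elements are
  \<open>1\<close> and \<open>2\<close> (there \<open>2 = 0\<close>), so that the coordinates are \<open>x $ 1\<close> and \<open>x $ 2\<close>.\<close>

definition laplacian :: "(real ^ 2 \<Rightarrow> 'b::real_normed_vector) \<Rightarrow> real ^ 2 \<Rightarrow> 'b"
  where "laplacian f x =
    partial_deriv 1 (partial_deriv 1 f) x + partial_deriv 2 (partial_deriv 2 f) x"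

text \<open>For open \<open>S\<close>, the predicate \<open>Ck_on k S f\<close> says that \<open>f\<close> is of class \<open>C^k\<close> on \<open>S\<close>:
  \<open>f\<close> is Frechet differentiable on \<open>S\<close> and every directional derivative is of class
  \<open>C^(k-1)\<close>. Only the values of \<open>f\<close> on \<open>S\<close> matter, since \<open>S\<close> is open.\<close>

fun Ck_on :: "nat \<Rightarrow> 'a::real_normed_vector set \<Rightarrow> ('a \<Rightarrow> 'b::real_normed_vector) \<Rightarrow> bool"
  where
    "Ck_on 0 S f \<longleftrightarrow> continuous_on S f"
  | "Ck_on (Suc k) S f \<longleftrightarrow>
      (\<forall>x\<in>S. f differentiable (at x)) \<and>
      (\<forall>v. Ck_on k S (\<lambda>x. frechet_derivative f (at x) v))"

definition smooth_on :: "'a::real_normed_vector set \<Rightarrow> ('a \<Rightarrow> 'b::real_normed_vector) \<Rightarrow> bool"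
  where "smooth_on S f \<longleftrightarrow> (\<forall>k. Ck_on k S f)"

definition vanishes_to_infinite_order_at_0 ::
    "('a::real_normed_vector \<Rightarrow> 'b::real_normed_vector) \<Rightarrow> bool"
  where "vanishes_to_infinite_order_at_0 u \<longleftrightarrow>
    (\<forall>N::nat. \<exists>C::real. \<forall>\<^sub>F x in nhds 0. norm (u x) \<le> C * norm x ^ N)"

lemma partial_deriv_eq_frechet_derivative:
  assumes "f differentiable (at x)"
  shows "partial_deriv i f x = frechet_derivative f (at x) (axis i 1)"
proof -
  let ?D = "frechet_derivative f (at x)"
  have D: "(f has_derivative ?D) (at x)"
    using assms frechet_derivative_works by blast
  have "((\<lambda>t::real. x + t *\<^sub>R axis i 1) has_derivative (\<lambda>t. t *\<^sub>R axis i 1)) (at 0)"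
    by (auto intro!: derivative_eq_intros)
  then have "((\<lambda>t. f (x + t *\<^sub>R axis i 1)) has_derivative (\<lambda>t. ?D (t *\<^sub>R axis i 1))) (at 0)"
    by (rule has_derivative_compose) (use D in simp)
  then have "((\<lambda>t. f (x + t *\<^sub>R axis i 1)) has_vector_derivative ?D (axis i 1)) (at 0)"
    using linear_frechet_derivative[OF assms]
    by (simp add: has_vector_derivative_def linear_cmul)
  then show ?thesis
    unfolding partial_deriv_def by (rule vector_derivative_at)
qed

end

theory Submission
  imports Defs
begin

text \<open>
  In two dimensions the Laplacian factors through the Wirtinger operators, \<open>\<Delta> = 4 \<partial>' \<partial>\<close>. Hence the
  triple \<open>W = (u, 2 \<partial> u, 2 \<partial>' u)\<close> satisfies a first-order inequality
  \<open>\<bar>W\<^sub>1 + J W\<^sub>2\<bar> \<le> C' \<bar>W\<bar>\<close>, with \<open>J\<close> an orthogonal complex structure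
  (\<open>laplace_strong_unique_continuation_ball\<close>). A function satisfying such a perturbed Cauchy-Riemann
  equation on a ball behaves like a holomorphic one: unless it is zero, it vanishes only to finite
  order at the centre (\<open>cauchy_riemann_strong_unique_continuation\<close>).

  The reason is a frequency function. Let \<open>h r\<close> be the integral of \<open>\<bar>W\<bar>\<^sup>2\<close> over the angles on the
  circle of radius \<open>r\<close>, and let \<open>Q r\<close> be the quadratic form of the angular operator \<open>- J \<partial>\<^sub>t\<close> at
  \<open>W\<close>. For \<open>W = z ^ k\<close> the quotient \<open>q = Q / h\<close> is \<open>k\<close>; for holomorphic \<open>W\<close> it is nondecreasing
  in \<open>r\<close>, by Cauchy-Schwarz. The perturbation costs only a bounded amount:
  \<open>q + C'\<^sup>2 r\<^sup>2 / 4\<close> is nondecreasing (\<open>circle_energy_lower_bound\<close>). So \<open>q\<close> stays bounded above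
  as \<open>r\<close> tends to \<open>0\<close>, and since \<open>h'\<close> is at most \<open>(2 q / r + 2 C') h\<close>, the function \<open>h\<close> is
  bounded below by a multiple of a power of \<open>r\<close> (\<open>frequency_lower_bound\<close>). The argument uses
  calculus in the radius and integrals over circles only; neither singular weights nor cut-off
  functions enter.

  The hypothesis concerns \<open>u\<close> alone, but an interpolation inequality transfers vanishing to infinite
  order to the first derivatives (\<open>flat_at_partial_deriv\<close>). Finally, the ball on which \<open>u\<close> is shown
  to vanish is any ball inside \<open>X\<close> about the given point, so the interior of the zero set of \<open>u\<close> is
  closed in \<open>X\<close>, and connectedness concludes.
\<close>

section \<open>Smooth functions and their partial derivatives\<close>

text \<open>\<open>Ck_on\<close> is stated through \<open>frechet_derivative\<close>, which depends on the values near each point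
  only; this is what allows the derivatives below to be replaced by explicit formulas valid
  on \<open>S\<close>.\<close>

lemma Ck_on_cong:
  assumes "open S" "\<And>x. x \<in> S \<Longrightarrow> f x = g x" "Ck_on k S f"
  shows "Ck_on k S g"
  using assms(2,3)
proof (induction k arbitrary: f g)
  case 0
  then show ?case by (simp cong: continuous_on_cong)
next
  case (Suc k)
  have diff: "f differentiable at x" if "x \<in> S" for x
    using Suc.prems that by simp
  have eq: "frechet_derivative f (at x) = frechet_derivative g (at x)" if "x \<in> S" for x
    by (rule frechet_derivative_transform_within_open[OF diff[OF that] \<open>open S\<close> that Suc.prems(1)])
  have "g differentiable at x" if "x \<in> S" for x
    by (meson diff[OF that] \<open>open S\<close> that Suc.prems(1) differentiable_def
        has_derivative_transform_within_open)
  moreover have "Ck_on k S (\<lambda>x. frechet_derivative g (at x) v)" for v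
    by (rule Suc.IH[of "\<lambda>x. frechet_derivative f (at x) v"]) (use Suc.prems eq in auto)
  ultimately show ?case by simp
qed

lemma smooth_on_cong:
  assumes "open S" "\<And>x. x \<in> S \<Longrightarrow> f x = g x" "smooth_on S f"
  shows "smooth_on S g"
  using assms Ck_on_cong unfolding smooth_on_def by blast

lemma smooth_on_imp_continuous_on: "smooth_on S f \<Longrightarrow> continuous_on S f"
  unfolding smooth_on_def using Ck_on.simps(1) by blast

lemma smooth_on_imp_differentiable: "smooth_on S f \<Longrightarrow> x \<in> S \<Longrightarrow> f differentiable at x"
  unfolding smooth_on_def using Ck_on.simps(2) by blast

lemma smooth_on_frechet_derivative:
  "smooth_on S f \<Longrightarrow> smooth_on S (\<lambda>x. frechet_derivative f (at x) v)"
  unfolding smooth_on_def using Ck_on.simps(2) by blast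

lemma smooth_on_subset: "smooth_on S f \<Longrightarrow> T \<subseteq> S \<Longrightarrow> smooth_on T f"
proof -
  have "Ck_on k S f \<Longrightarrow> T \<subseteq> S \<Longrightarrow> Ck_on k T f" for k
    by (induction k arbitrary: f) (auto intro: continuous_on_subset)
  then show "smooth_on S f \<Longrightarrow> T \<subseteq> S \<Longrightarrow> smooth_on T f"
    unfolding smooth_on_def by blast
qed

lemma smooth_on_partial_deriv:
  assumes "open S" "smooth_on S f"
  shows "smooth_on S (partial_deriv i f)"
proof (rule smooth_on_cong[OF assms(1) _ smooth_on_frechet_derivative[OF assms(2), of "axis i 1"]])
  show "frechet_derivative f (at x) (axis i 1) = partial_deriv i f x" if "x \<in> S" for x
    using partial_deriv_eq_frechet_derivative[OF smooth_on_imp_differentiable[OF assms(2) that]]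
    by simp
qed

lemma partial_deriv_at:
  assumes "(f has_derivative f') (at x)"
  shows "partial_deriv i f x = f' (axis i 1)"
  using assms partial_deriv_eq_frechet_derivative[of f x i] frechet_derivative_at
  by (metis differentiableI)

text \<open>From here on all calculus is done with the two partial derivatives, so that the chain rule along
  curves reads off the coordinates of the velocity.\<close>

lemma has_derivative_partial_deriv:
  fixes f :: "real ^ 2 \<Rightarrow> 'b::real_normed_vector"
  assumes "smooth_on S f" "x \<in> S"
  shows "(f has_derivative (\<lambda>h. (h $ 1) *\<^sub>R partial_deriv 1 f x + (h $ 2) *\<^sub>R partial_deriv 2 f x)) (at x)"
proof -
  let ?D = "frechet_derivative f (at x)"
  have d: "f differentiable at x" using smooth_on_imp_differentiable assms by blast
  have lin: "linear ?D" using linear_frechet_derivative[OF d] .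
  have "?D h = (h $ 1) *\<^sub>R partial_deriv 1 f x + (h $ 2) *\<^sub>R partial_deriv 2 f x" for h
  proof -
    have "h = (h $ 1) *\<^sub>R axis 1 1 + (h $ 2) *\<^sub>R axis 2 1"
      by (simp add: vec_eq_iff axis_def forall_2)
    then have "?D h = ?D ((h $ 1) *\<^sub>R axis 1 1 + (h $ 2) *\<^sub>R axis 2 1)" by simp
    then show ?thesis
      by (simp add: linear_add[OF lin] linear_cmul[OF lin] partial_deriv_eq_frechet_derivative[OF d])
  qed
  then have "?D = (\<lambda>h. (h $ 1) *\<^sub>R partial_deriv 1 f x + (h $ 2) *\<^sub>R partial_deriv 2 f x)"
    by blast
  then show ?thesis using d frechet_derivative_works by metis
qed

lemma smooth_on_bounded_linear:
  assumes "bounded_linear L" "open S" "smooth_on S f"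
  shows "smooth_on S (\<lambda>x. L (f x))"
proof -
  have "Ck_on k S f \<Longrightarrow> Ck_on k S (\<lambda>x. L (f x))" for k
  proof (induction k arbitrary: f)
    case 0
    then show ?case
      using bounded_linear.continuous_on[OF assms(1)] by auto
  next
    case (Suc k)
    have D: "((\<lambda>x. L (f x)) has_derivative (\<lambda>h. L (frechet_derivative f (at x) h))) (at x)"
      if "x \<in> S" for x
      using that Suc.prems frechet_derivative_works
      by (intro bounded_linear.has_derivative[OF assms(1)]) auto
    have "Ck_on k S (\<lambda>x. frechet_derivative (\<lambda>x. L (f x)) (at x) v)" for v
      by (rule Ck_on_cong[OF assms(2) _ Suc.IH[of "\<lambda>x. frechet_derivative f (at x) v"]])
         (use Suc.prems frechet_derivative_at[OF D] in \<open>auto dest: fun_cong\<close>)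
    then show ?case using D by (auto intro: differentiableI)
  qed
  then show ?thesis using assms(3) unfolding smooth_on_def by blast
qed

lemma smooth_on_Pair:
  assumes "open S" "smooth_on S f" "smooth_on S g"
  shows "smooth_on S (\<lambda>x. (f x, g x))"
proof -
  have "Ck_on k S f \<Longrightarrow> Ck_on k S g \<Longrightarrow> Ck_on k S (\<lambda>x. (f x, g x))" for k
  proof (induction k arbitrary: f g)
    case 0
    then show ?case by (auto intro: continuous_on_Pair)
  next
    case (Suc k)
    have D: "((\<lambda>x. (f x, g x)) has_derivative
        (\<lambda>h. (frechet_derivative f (at x) h, frechet_derivative g (at x) h))) (at x)"
      if "x \<in> S" for x
      using that Suc.prems by (intro has_derivative_Pair) (auto simp flip: frechet_derivative_works)
    have "Ck_on k S (\<lambda>x. frechet_derivative (\<lambda>x. (f x, g x)) (at x) v)" for v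
      by (rule Ck_on_cong[OF assms(1) _ Suc.IH[of "\<lambda>x. frechet_derivative f (at x) v"
              "\<lambda>x. frechet_derivative g (at x) v"]])
         (use Suc.prems frechet_derivative_at[OF D] in \<open>auto dest: fun_cong\<close>)
    then show ?case using D by (auto intro: differentiableI)
  qed
  then show ?thesis using assms unfolding smooth_on_def by blast
qed

section \<open>Symmetry of second derivatives\<close>

text \<open>Only one of the two mixed derivatives, \<open>fyx\<close>, is assumed continuous. Writing
  \<open>f s t - f s (-e)\<close> as the integral of \<open>fy s\<close> and differentiating under the integral sign at
  \<open>s = 0\<close> shows that \<open>fx\<close> is a primitive of \<open>fyx 0\<close>, up to a constant.\<close>

lemma mixed_partials_commute_real:
  fixes f :: "real \<Rightarrow> real \<Rightarrow> 'a::euclidean_space"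
  assumes "e > 0"
    and fy: "\<And>s t. \<bar>s\<bar> \<le> e \<Longrightarrow> \<bar>t\<bar> \<le> e \<Longrightarrow> ((\<lambda>t. f s t) has_vector_derivative fy s t) (at t)"
    and fx: "\<And>t. \<bar>t\<bar> \<le> e \<Longrightarrow> ((\<lambda>s. f s t) has_vector_derivative fx t) (at 0)"
    and fyx: "\<And>s t. \<bar>s\<bar> \<le> e \<Longrightarrow> \<bar>t\<bar> \<le> e \<Longrightarrow> ((\<lambda>s. fy s t) has_vector_derivative fyx s t) (at s)"
    and cy: "\<And>s. \<bar>s\<bar> \<le> e \<Longrightarrow> continuous_on {-e..e} (fy s)"
    and cyx: "continuous_on ({-e..e} \<times> {-e..e}) (\<lambda>(s, t). fyx s t)"
    and fxy: "(fx has_vector_derivative D) (at 0)"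
  shows "D = fyx 0 0"
proof -
  have int: "integral (cbox (-e) t) (fy s) = f s t - f s (-e)" if "\<bar>s\<bar> \<le> e" "\<bar>t\<bar> \<le> e" for s t
    unfolding cbox_interval
    by (intro integral_unique fundamental_theorem_of_calculus)
       (use that fy[of s] in \<open>auto intro: has_vector_derivative_at_within\<close>)
  have key: "fx t - fx (-e) = integral (cbox (-e) t) (fyx 0)" if "\<bar>t\<bar> \<le> e" for t
  proof -
    have 1: "((\<lambda>s. integral (cbox (-e) t) (fy s)) has_vector_derivative
         integral (cbox (-e) t) (fyx 0)) (at 0 within {-e..e})"
    proof (rule leibniz_rule_vector_derivative)
      show "((\<lambda>s. fy s t') has_vector_derivative fyx s t') (at s within {-e..e})"
        if "s \<in> {-e..e}" "t' \<in> cbox (-e) t" for s t'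
        using fyx[of s t'] that \<open>\<bar>t\<bar> \<le> e\<close> by (auto intro: has_vector_derivative_at_within)
      show "fy s integrable_on cbox (-e) t" if "s \<in> {-e..e}" for s
        by (rule integrable_continuous, rule continuous_on_subset[OF cy])
           (use that \<open>\<bar>t\<bar> \<le> e\<close> in auto)
      show "continuous_on ({-e..e} \<times> cbox (-e) t) (\<lambda>(s, t). fyx s t)"
        by (rule continuous_on_subset[OF cyx]) (use \<open>\<bar>t\<bar> \<le> e\<close> in auto)
    qed (use \<open>e > 0\<close> in auto)
    have at: "(at 0 within {-e..e}) = at (0::real)"
      using \<open>e > 0\<close> by (simp add: at_within_Icc_at)
    have "((\<lambda>s. f s t - f s (-e)) has_vector_derivative integral (cbox (-e) t) (fyx 0)) (at 0)"
      by (rule has_vector_derivative_transform_within_open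
          [of "\<lambda>s. integral (cbox (-e) t) (fy s)" _ _ "{-e<..<e}"])
         (use 1 int \<open>\<bar>t\<bar> \<le> e\<close> \<open>e > 0\<close> in \<open>auto simp: at\<close>)
    moreover have "((\<lambda>s. f s t - f s (-e)) has_vector_derivative fx t - fx (-e)) (at 0)"
      by (intro derivative_intros fx) (use that \<open>e > 0\<close> in auto)
    ultimately show ?thesis by (rule vector_derivative_unique_at[rotated])
  qed
  have cont: "continuous_on {-e..e} (fyx 0)"
    by (rule continuous_on_compose2[OF cyx, of _ "\<lambda>t. (0, t)", simplified])
       (use \<open>e > 0\<close> in \<open>auto intro!: continuous_intros\<close>)
  have "((\<lambda>t. integral {-e..t} (fyx 0)) has_vector_derivative fyx 0 0) (at 0 within {-e..e})"
    by (rule integral_has_vector_derivative[OF cont]) (use \<open>e > 0\<close> in auto)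
  moreover have at: "(at 0 within {-e..e}) = at (0::real)"
    using \<open>e > 0\<close> by (simp add: at_within_Icc_at)
  ultimately have "((\<lambda>t. integral {-e..t} (fyx 0)) has_vector_derivative fyx 0 0) (at 0)"
    by simp
  then have "((\<lambda>t. fx t - fx (-e)) has_vector_derivative fyx 0 0) (at 0)"
    by (rule has_vector_derivative_transform_within_open[of _ _ _ "{-e<..<e}"])
       (use key \<open>e > 0\<close> in \<open>auto simp: cbox_interval\<close>)
  moreover have "((\<lambda>t. fx t - fx (-e)) has_vector_derivative D - 0) (at 0)"
    by (intro derivative_intros fxy)
  ultimately show ?thesis using vector_derivative_unique_at by fastforce
qed

lemma has_vector_derivative_along_curve:
  fixes f :: "real ^ 2 \<Rightarrow> 'b::real_normed_vector"
  assumes "smooth_on S f" "c t \<in> S" "(c has_vector_derivative c') (at t)"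
  shows "((\<lambda>t. f (c t)) has_vector_derivative
      (c' $ 1) *\<^sub>R partial_deriv 1 f (c t) + (c' $ 2) *\<^sub>R partial_deriv 2 f (c t)) (at t)"
  using has_derivative_compose[OF assms(3)[unfolded has_vector_derivative_def]
     has_derivative_partial_deriv[OF assms(1,2)]]
  by (simp add: has_vector_derivative_def algebra_simps)

lemma mixed_partials_commute:
  fixes f :: "real ^ 2 \<Rightarrow> 'a::euclidean_space"
  assumes "open S" "smooth_on S f" "x \<in> S"
  shows "partial_deriv 1 (partial_deriv 2 f) x = partial_deriv 2 (partial_deriv 1 f) x"
proof -
  obtain r where r: "r > 0" "ball x r \<subseteq> S"
    using assms openE by blast
  define e where "e = r / 3"
  define c where "c = (\<lambda>s t. x + s *\<^sub>R axis 1 1 + t *\<^sub>R axis 2 (1::real))"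
  have e: "e > 0" using r by (simp add: e_def)
  have inS: "c s t \<in> S" if "\<bar>s\<bar> \<le> e" "\<bar>t\<bar> \<le> e" for s t
  proof -
    have "norm (s *\<^sub>R axis 1 1 + t *\<^sub>R axis 2 1 :: real^2) \<le> \<bar>s\<bar> + \<bar>t\<bar>"
      by (rule norm_triangle_le) (simp add: norm_axis_1)
    also have "\<dots> < r" using that r by (simp add: e_def)
    finally have "dist (c s t) x < r" by (simp add: c_def dist_norm add.assoc)
    then have "c s t \<in> ball x r" by (simp add: dist_commute)
    then show ?thesis using r by auto
  qed
  have sm: "smooth_on S (partial_deriv i f)" "smooth_on S (partial_deriv j (partial_deriv i f))" for i j
    using smooth_on_partial_deriv assms by blast+
  have ax: "axis 1 (1::real) $ (1::2) = 1" "axis 1 (1::real) $ (2::2) = 0"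
     "axis 2 (1::real) $ (1::2) = 0" "axis 2 (1::real) $ (2::2) = 1"
    by (simp_all add: axis_def)
  have cs: "((\<lambda>s. c s t) has_vector_derivative axis 1 1) (at s)" for s t
    unfolding c_def by (auto intro!: derivative_eq_intros)
  have ct: "((\<lambda>t. c s t) has_vector_derivative axis 2 1) (at t)" for s t
    unfolding c_def by (auto intro!: derivative_eq_intros)
  have Ds: "((\<lambda>s. g (c s t)) has_vector_derivative partial_deriv 1 g (c s t)) (at s)"
    if "\<bar>s\<bar> \<le> e" "\<bar>t\<bar> \<le> e" "smooth_on S g" for g :: "real ^ 2 \<Rightarrow> 'a" and s t
    using has_vector_derivative_along_curve[OF that(3) inS[OF that(1,2)] cs] by (simp add: ax)
  have Dt: "((\<lambda>t. g (c s t)) has_vector_derivative partial_deriv 2 g (c s t)) (at t)"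
    if "\<bar>s\<bar> \<le> e" "\<bar>t\<bar> \<le> e" "smooth_on S g" for g :: "real ^ 2 \<Rightarrow> 'a" and s t
    using has_vector_derivative_along_curve[OF that(3) inS[OF that(1,2)] ct] by (simp add: ax)
  have "partial_deriv 2 (partial_deriv 1 f) (c 0 0) = partial_deriv 1 (partial_deriv 2 f) (c 0 0)"
  proof (rule mixed_partials_commute_real[OF e, where f = "\<lambda>s t. f (c s t)"
        and fx = "\<lambda>t. partial_deriv 1 f (c 0 t)" and fy = "\<lambda>s t. partial_deriv 2 f (c s t)"
        and fyx = "\<lambda>s t. partial_deriv 1 (partial_deriv 2 f) (c s t)"])
    show "((\<lambda>t. f (c s t)) has_vector_derivative partial_deriv 2 f (c s t)) (at t)"
      if "\<bar>s\<bar> \<le> e" "\<bar>t\<bar> \<le> e" for s t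
      using Dt that assms by blast
    show "((\<lambda>s. f (c s t)) has_vector_derivative partial_deriv 1 f (c 0 t)) (at 0)"
      if "\<bar>t\<bar> \<le> e" for t
      using Ds[of 0] that assms e by simp
    show "((\<lambda>s. partial_deriv 2 f (c s t)) has_vector_derivative
        partial_deriv 1 (partial_deriv 2 f) (c s t)) (at s)"
      if "\<bar>s\<bar> \<le> e" "\<bar>t\<bar> \<le> e" for s t
      using Ds that sm by blast
    show "((\<lambda>t. partial_deriv 1 f (c 0 t)) has_vector_derivative
        partial_deriv 2 (partial_deriv 1 f) (c 0 0)) (at 0)"
      using Dt[of 0 0] sm e by simp
    show "continuous_on {-e..e} (\<lambda>t. partial_deriv 2 f (c s t))" if "\<bar>s\<bar> \<le> e" for s
      by (rule continuous_on_compose2[OF smooth_on_imp_continuous_on[OF sm(1)]])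
         (use inS that in \<open>auto simp: c_def intro!: continuous_intros\<close>)
    show "continuous_on ({-e..e} \<times> {-e..e}) (\<lambda>(s, t). partial_deriv 1 (partial_deriv 2 f) (c s t))"
      unfolding split_beta
      by (rule continuous_on_compose2[OF smooth_on_imp_continuous_on[OF sm(2)]])
         (use inS in \<open>auto simp: c_def intro!: continuous_intros\<close>)
  qed
  then show ?thesis by (simp add: c_def)
qed

section \<open>A differential inequality for the frequency\<close>

text \<open>The quotient \<open>q = Q / h\<close> is the frequency: for \<open>h r = r ^ (2 * k)\<close> with equality in \<open>growth\<close> and
  \<open>A = 0\<close> it is the constant \<open>k\<close>. The hypothesis \<open>monotone\<close> says \<open>q' \<ge> - B * r\<close> wherever
  \<open>h > 0\<close>, since \<open>Q' - q * h' = q' * h\<close>. So \<open>q\<close> stays bounded above as \<open>r\<close> decreases from \<open>r0\<close>,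
  and then \<open>growth\<close> bounds the logarithmic derivative \<open>h' / h\<close> by \<open>m / r + A\<close>: going inwards, \<open>h\<close>
  cannot decay faster than a multiple of \<open>r ^ m\<close>. The same bound prevents \<open>h\<close> from reaching zero
  at a positive radius, so dividing by \<open>h\<close> is legitimate all the way down.\<close>

lemma frequency_lower_bound:
  fixes h Q h' Q' :: "real \<Rightarrow> real"
  assumes hD: "\<And>r. 0 < r \<Longrightarrow> r < R \<Longrightarrow> (h has_real_derivative h' r) (at r)"
    and QD: "\<And>r. 0 < r \<Longrightarrow> r < R \<Longrightarrow> (Q has_real_derivative Q' r) (at r)"
    and h0: "\<And>r. 0 < r \<Longrightarrow> r < R \<Longrightarrow> 0 \<le> h r"
    and growth: "\<And>r. 0 < r \<Longrightarrow> r < R \<Longrightarrow> h' r \<le> 2 / r * Q r + A * h r"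
    and monotone: "\<And>r q. 0 < r \<Longrightarrow> r < R \<Longrightarrow> Q r = q * h r \<Longrightarrow> - (B * r * h r) \<le> Q' r - q * h' r"
    and r0: "0 < r0" "r0 < R" "h r0 > 0"
  shows "\<exists>m c. c > 0 \<and> (\<forall>r. 0 < r \<and> r \<le> r0 \<longrightarrow> c * r ^ m \<le> h r)"
proof -
  obtain m :: nat where m: "2 * (Q r0 / h r0 + \<bar>B\<bar> / 2 * r0\<^sup>2) \<le> real m"
    using real_arch_simple by blast
  define g where "g = (\<lambda>r. h r * exp (- A * r) / r ^ m)"
  \<comment> \<open>The estimate on an interval where \<open>h\<close> is already known to be positive.\<close>
  have step: "g r0 \<le> g r1" if r1: "0 < r1" "r1 \<le> r0" and pos: "\<And>r. r1 \<le> r \<Longrightarrow> r \<le> r0 \<Longrightarrow> h r > 0" for r1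
  proof -
    have Qle: "2 * Q r \<le> m * h r" if r: "r1 \<le> r" "r \<le> r0" for r
    proof -
      have "Q r / h r + \<bar>B\<bar> / 2 * r\<^sup>2 \<le> Q r0 / h r0 + \<bar>B\<bar> / 2 * r0\<^sup>2"
      proof (rule DERIV_nonneg_imp_nondecreasing[OF r(2)])
        fix s assume s: "r \<le> s" "s \<le> r0"
        then have s': "0 < s" "s < R" "h s > 0" using r r1 r0 pos by auto
        have "((\<lambda>r. Q r / h r + \<bar>B\<bar> / 2 * r\<^sup>2) has_real_derivative
            (Q' s * h s - Q s * h' s) / (h s * h s) + \<bar>B\<bar> * s) (at s)"
          using s' by (auto intro!: derivative_eq_intros hD QD)
        moreover have "(Q' s * h s - Q s * h' s) / (h s * h s) = (Q' s - Q s / h s * h' s) / h s"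
          using s' by (simp add: field_simps)
        moreover have "(Q' s - Q s / h s * h' s) / h s \<ge> - (B * s * h s) / h s"
          by (rule divide_right_mono[OF monotone]) (use s' in auto)
        moreover have "- (B * s * h s) / h s = - (B * s)" using s' by simp
        moreover have "B * s \<le> \<bar>B\<bar> * s" using s' by (simp add: mult_right_mono)
        ultimately show "\<exists>y. ((\<lambda>r. Q r / h r + \<bar>B\<bar> / 2 * r\<^sup>2) has_real_derivative y) (at s) \<and> 0 \<le> y"
          by (intro exI[of _ "(Q' s * h s - Q s * h' s) / (h s * h s) + \<bar>B\<bar> * s"]) auto
      qed
      moreover have "0 \<le> \<bar>B\<bar> / 2 * r\<^sup>2" by simp
      ultimately have "2 * (Q r / h r) \<le> m" using m by argo
      then show ?thesis using pos[OF r] by (simp add: field_simps)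
    qed
    show ?thesis
    proof (rule DERIV_nonpos_imp_nonincreasing[OF r1(2)])
      fix s assume s: "r1 \<le> s" "s \<le> r0"
      then have s': "0 < s" "s < R" "h s > 0" using r1 r0 pos by auto
      have "(g has_real_derivative
          (((h' s * exp (- A * s) + h s * (exp (- A * s) * (- A))) * s ^ m
             - h s * exp (- A * s) * (m * s ^ (m - 1))) / (s ^ m * s ^ m))) (at s)"
        unfolding g_def using s' by (auto intro!: derivative_eq_intros hD)
      moreover have "(((h' s * exp (- A * s) + h s * (exp (- A * s) * (- A))) * s ^ m
             - h s * exp (- A * s) * (m * s ^ (m - 1))) / (s ^ m * s ^ m))
          = exp (- A * s) * (h' s - A * h s - m / s * h s) / s ^ m"
        using s' by (cases m) (simp_all add: field_simps)
      moreover have "h' s - A * h s - m / s * h s \<le> 0"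
      proof -
        have "2 / s * Q s \<le> m / s * h s"
          using Qle[OF s] s' by (simp add: field_simps)
        then show ?thesis using growth[OF s'(1,2)] by argo
      qed
      ultimately show "\<exists>y. (g has_real_derivative y) (at s) \<and> y \<le> 0"
        using s' by (intro exI[of _ "exp (- A * s) * (h' s - A * h s - m / s * h s) / s ^ m"])
           (auto simp: divide_nonpos_pos mult_nonneg_nonpos)
    qed
  qed
  have g0: "g r0 > 0" using r0 by (simp add: g_def)
  have cont: "continuous_on {0<..<R} h"
    by (rule DERIV_continuous_on) (use hD in \<open>auto intro: has_field_derivative_at_within\<close>)
  have pos: "h r > 0" if r: "0 < r" "r \<le> r0" for r
  proof (rule ccontr)
    assume "\<not> h r > 0"
    then have hr: "h r = 0" using h0[of r] r r0 by force
    \<comment> \<open>At the largest zero \<open>z\<close> of \<open>h\<close> below \<open>r0\<close>, letting \<open>s\<close> decrease to \<open>z\<close> in \<open>g r0 \<le> g s\<close> gives a contradiction.\<close>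
    define Z where "Z = {s \<in> {r..r0}. h s = 0}"
    have Z_eq: "Z = {r..r0} \<inter> ({r..r0} \<inter> h -` {0})" unfolding Z_def by blast
    have "compact Z"
    proof -
      have "closed ({r..r0} \<inter> h -` {0})"
        by (rule continuous_closed_preimage[OF continuous_on_subset[OF cont]]) (use r r0 in auto)
      then show ?thesis
        using compact_Int_closed[OF compact_Icc[of r r0]] unfolding Z_eq by blast
    qed
    moreover have "r \<in> Z" using hr r by (simp add: Z_def)
    ultimately obtain z where z: "z \<in> Z" "\<And>s. s \<in> Z \<Longrightarrow> s \<le> z"
      using compact_attains_sup[of Z] by blast
    have z': "0 < z" "z < r0" "h z = 0" using z(1) r r0 unfolding Z_def by (auto simp: less_le)
    have hp: "h s > 0" if "z < s" "s \<le> r0" for s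
    proof -
      have "s \<notin> Z" using z(2)[of s] that by auto
      then have "h s \<noteq> 0" using that z(1) unfolding Z_def by auto
      then show ?thesis using h0[of s] that z' r0 by auto
    qed
    have "\<forall>\<^sub>F s in at_right z. g r0 \<le> g s"
      unfolding eventually_at_right_field using z'
      by (intro exI[of _ r0]) (auto intro!: step hp)
    moreover have "(g \<longlongrightarrow> g z) (at_right z)"
    proof -
      have "isCont h z" using hD[of z] z' r0 DERIV_isCont by fastforce
      then have "isCont g z" unfolding g_def using z' by (auto intro!: continuous_intros)
      then show ?thesis by (simp add: isCont_def filterlim_at_split)
    qed
    ultimately have "g r0 \<le> g z"
      by (intro tendsto_lowerbound) auto
    then show False using g0 z' by (simp add: g_def)
  qed
  define c where "c = g r0 * exp (- \<bar>A\<bar> * r0)"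
  have "c * r ^ m \<le> h r" if r: "0 < r" "r \<le> r0" for r
  proof -
    have "g r0 \<le> g r" using step[OF r] pos r by force
    then have "g r0 * r ^ m \<le> h r * exp (- A * r)"
      using r by (simp add: g_def field_simps)
    then have "g r0 * r ^ m * exp (A * r) \<le> h r * exp (- A * r) * exp (A * r)"
      by (rule mult_right_mono) simp
    also have "\<dots> = h r" by (simp add: exp_minus)
    finally have 1: "g r0 * r ^ m * exp (A * r) \<le> h r" .
    have "- \<bar>A\<bar> * r0 \<le> A * r"
    proof -
      have "\<bar>A\<bar> * r \<le> \<bar>A\<bar> * r0" using r by (intro mult_left_mono) auto
      moreover have "- (A * r) \<le> \<bar>A\<bar> * r" using r mult_right_mono[of "- A" "\<bar>A\<bar>" r] by simp
      ultimately show ?thesis by simp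
    qed
    then have "c * r ^ m \<le> g r0 * r ^ m * exp (A * r)"
      unfolding c_def using g0 r by (simp add: mult.assoc mult.left_commute mult_left_mono)
    then show ?thesis using 1 by linarith
  qed
  then show ?thesis using g0 by (intro exI[of _ m] exI[of _ c]) (auto simp: c_def)
qed

section \<open>Perturbed Cauchy-Riemann systems\<close>

text \<open>A function \<open>V\<close> of polar coordinates with \<open>V\<^sub>r = - J V\<^sub>t / r + F\<close> and \<open>\<bar>F\<bar> \<le> C \<bar>V\<bar>\<close> solves a
  perturbed evolution equation in \<open>r\<close> on the circle, whose generator \<open>- J \<partial>\<^sub>t\<close> is symmetric in
  \<open>L\<^sup>2\<close>. Take \<open>h = \<parallel>V\<parallel>\<^sup>2\<close> and \<open>Q = \<langle>V, - J V\<^sub>t\<rangle>\<close>. Symmetry gives \<open>Q' = 2 \<langle>V\<^sub>r, - J V\<^sub>t\<rangle>\<close>, and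
  with the component \<open>P = - J V\<^sub>t - q V\<close> of \<open>- J V\<^sub>t\<close> orthogonal to \<open>V\<close> in \<open>L\<^sup>2\<close> one finds
  \<open>Q' - q h' = (2 / r) \<parallel>P\<parallel>\<^sup>2 + 2 \<langle>F, P\<rangle> \<ge> - (r / 2) \<parallel>F\<parallel>\<^sup>2 \<ge> - (C\<^sup>2 / 2) r h\<close>,
  which is the almost monotonicity of the frequency. For \<open>F = 0\<close> the function is holomorphic, and
  \<open>Q' - q h' \<ge> 0\<close> is the Cauchy-Schwarz inequality behind the \<open>L\<^sup>2\<close> form of the Hadamard three
  circles theorem.\<close>

lemma circle_energy_lower_bound:
  fixes V Vr Vt Vrt :: "real \<Rightarrow> real \<Rightarrow> 'e::euclidean_space" and J :: "'e \<Rightarrow> 'e"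
  assumes J: "bounded_linear J" and skew: "\<And>x y. J x \<bullet> y = - (x \<bullet> J y)"
    and V_r: "\<And>r t. 0 < r \<Longrightarrow> r < R \<Longrightarrow> ((\<lambda>r. V r t) has_vector_derivative Vr r t) (at r)"
    and V_t: "\<And>r t. 0 < r \<Longrightarrow> r < R \<Longrightarrow> ((\<lambda>t. V r t) has_vector_derivative Vt r t) (at t)"
    and Vt_r: "\<And>r t. 0 < r \<Longrightarrow> r < R \<Longrightarrow> ((\<lambda>r. Vt r t) has_vector_derivative Vrt r t) (at r)"
    and Vr_t: "\<And>r t. 0 < r \<Longrightarrow> r < R \<Longrightarrow> ((\<lambda>t. Vr r t) has_vector_derivative Vrt r t) (at t)"
    and cont: "continuous_on ({0<..<R} \<times> UNIV) (\<lambda>x. V (fst x) (snd x))"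
      "continuous_on ({0<..<R} \<times> UNIV) (\<lambda>x. Vr (fst x) (snd x))"
      "continuous_on ({0<..<R} \<times> UNIV) (\<lambda>x. Vt (fst x) (snd x))"
      "continuous_on ({0<..<R} \<times> UNIV) (\<lambda>x. Vrt (fst x) (snd x))"
    and periodic: "\<And>r. V r (2 * pi) = V r 0" "\<And>r. Vr r (2 * pi) = Vr r 0"
    and CR: "\<And>r t. 0 < r \<Longrightarrow> r < R \<Longrightarrow> norm (Vr r t + (1 / r) *\<^sub>R J (Vt r t)) \<le> C * norm (V r t)"
    and r0: "0 < r0" "r0 < R" "0 \<le> s" "s \<le> 2 * pi" "V r0 s \<noteq> 0"
  shows "\<exists>m c. c > 0 \<and> (\<forall>r. 0 < r \<and> r \<le> r0 \<longrightarrow> c * r ^ m \<le> integral {0..2 * pi} (\<lambda>t. V r t \<bullet> V r t))"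
proof -
  note JI[continuous_intros] = bounded_linear.continuous_on[OF J]
  note JD = bounded_linear.has_vector_derivative[OF J]
  let ?I = "{0..2 * pi}"
  have slice: "continuous_on S (\<lambda>t. f r t)"
    if "continuous_on ({0<..<R} \<times> UNIV) (\<lambda>x. f (fst x) (snd x))" "0 < r" "r < R"
    for f :: "real \<Rightarrow> real \<Rightarrow> 'e" and r S
  proof -
    have "continuous_on S (\<lambda>t. f (fst (r, t)) (snd (r, t)))"
      by (rule continuous_on_compose2[OF that(1)]) (use that in \<open>auto intro!: continuous_intros\<close>)
    then show ?thesis by simp
  qed
  note ct[continuous_intros] = slice[OF cont(1)] slice[OF cont(2)] slice[OF cont(3)] slice[OF cont(4)]
  have joint: "continuous_on ({0<..<R} \<times> ?I) (\<lambda>x. f (fst x) (snd x))"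
    if "continuous_on ({0<..<R} \<times> UNIV) (\<lambda>x. f (fst x) (snd x))" for f :: "real \<Rightarrow> real \<Rightarrow> 'e"
    by (rule continuous_on_subset[OF that]) auto
  note cj[continuous_intros] = joint[OF cont(1)] joint[OF cont(2)] joint[OF cont(3)] joint[OF cont(4)]
  have diff_integral: "((\<lambda>r. integral ?I (f r)) has_real_derivative integral ?I (f' r)) (at r)"
    if f: "\<And>r t. 0 < r \<Longrightarrow> r < R \<Longrightarrow> ((\<lambda>r. f r t) has_real_derivative f' r t) (at r)"
      and "\<And>r. 0 < r \<Longrightarrow> r < R \<Longrightarrow> continuous_on ?I (f r)"
      and "continuous_on ({0<..<R} \<times> ?I) (\<lambda>x. f' (fst x) (snd x))"
      and r: "0 < r" "r < R"
    for f f' :: "real \<Rightarrow> real \<Rightarrow> real" and r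
  proof -
    have "((\<lambda>r. integral (cbox 0 (2 * pi)) (f r)) has_field_derivative
        integral (cbox 0 (2 * pi)) (f' r)) (at r within {0<..<R})"
      by (rule leibniz_rule_field_derivative)
         (use that in \<open>auto simp: split_beta intro: has_field_derivative_at_within integrable_continuous_real\<close>)
    then show ?thesis using r by (simp add: at_within_open[of r "{0<..<R}"])
  qed

  define h where "h = (\<lambda>r. integral ?I (\<lambda>t. V r t \<bullet> V r t))"
  define h' where "h' = (\<lambda>r. integral ?I (\<lambda>t. 2 * (V r t \<bullet> Vr r t)))"
  define Q where "Q = (\<lambda>r. integral ?I (\<lambda>t. - (V r t \<bullet> J (Vt r t))))"
  define Q' where "Q' = (\<lambda>r. integral ?I (\<lambda>t. - 2 * (Vr r t \<bullet> J (Vt r t))))"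

  have hI: "((\<lambda>t. V r t \<bullet> V r t) has_integral h r) ?I"
    and h'I: "((\<lambda>t. 2 * (V r t \<bullet> Vr r t)) has_integral h' r) ?I"
    and QI: "((\<lambda>t. - (V r t \<bullet> J (Vt r t))) has_integral Q r) ?I"
    and Q'I: "((\<lambda>t. - 2 * (Vr r t \<bullet> J (Vt r t))) has_integral Q' r) ?I"
    if "0 < r" "r < R" for r
    unfolding h_def h'_def Q_def Q'_def using that
    by (intro integrable_integral integrable_continuous_real continuous_intros that)+

  have hD: "(h has_real_derivative h' r) (at r)" if "0 < r" "r < R" for r
    unfolding h_def h'_def
  proof (rule diff_integral[OF _ _ _ that])
    fix r t assume r: "0 < r" "r < R"
    show "((\<lambda>r. V r t \<bullet> V r t) has_real_derivative 2 * (V r t \<bullet> Vr r t)) (at r)"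
      using bounded_bilinear.has_vector_derivative[OF bounded_bilinear_inner V_r[OF r, of t] V_r[OF r, of t]]
      by (simp add: has_real_derivative_iff_has_vector_derivative inner_commute)
  qed (auto intro!: continuous_intros)

  have QD: "(Q has_real_derivative Q' r) (at r)" if r: "0 < r" "r < R" for r
  proof -
    let ?q = "\<lambda>r t. - (Vr r t \<bullet> J (Vt r t)) - V r t \<bullet> J (Vrt r t)"
    have "(Q has_real_derivative integral ?I (?q r)) (at r)"
      unfolding Q_def
    proof (rule diff_integral[OF _ _ _ r])
      fix r t assume r: "0 < r" "r < R"
      show "((\<lambda>r. - (V r t \<bullet> J (Vt r t))) has_real_derivative
          - (Vr r t \<bullet> J (Vt r t)) - V r t \<bullet> J (Vrt r t)) (at r)"
        by (rule DERIV_cong[OF DERIV_minus[OF bounded_bilinear.has_vector_derivative[OF bounded_bilinear_inner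
              V_r[OF r] JD[OF Vt_r[OF r]], folded has_real_derivative_iff_has_vector_derivative]]]) simp
    qed (auto intro!: continuous_intros)
    moreover have "integral ?I (?q r) = Q' r"
    proof -
      \<comment> \<open>The boundary terms cancel by periodicity; together with \<open>skew\<close> this is the symmetry of \<open>- J \<partial>\<^sub>t\<close>.\<close>
      have by_parts: "((\<lambda>t. V r t \<bullet> J (Vrt r t) + Vt r t \<bullet> J (Vr r t)) has_integral
          V r (2 * pi) \<bullet> J (Vr r (2 * pi)) - V r 0 \<bullet> J (Vr r 0)) ?I"
        by (rule fundamental_theorem_of_calculus)
           (auto intro!: has_vector_derivative_at_within
              bounded_bilinear.has_vector_derivative[OF bounded_bilinear_inner V_t[OF r] JD[OF Vr_t[OF r]]])
      have "((\<lambda>t. - 2 * (Vr r t \<bullet> J (Vt r t))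
            - (V r t \<bullet> J (Vrt r t) + Vt r t \<bullet> J (Vr r t))) has_integral Q' r - 0) ?I"
        by (rule has_integral_diff[OF Q'I[OF r]]) (use by_parts periodic in simp)
      moreover have "- 2 * (Vr r t \<bullet> J (Vt r t)) - (V r t \<bullet> J (Vrt r t) + Vt r t \<bullet> J (Vr r t)) = ?q r t"
        for t using skew[of "Vt r t" "Vr r t"] skew[of "Vr r t" "Vt r t"]
        by (simp add: inner_commute)
      ultimately have "(?q r has_integral Q' r) ?I" by (simp only: diff_0_right)
      then show ?thesis by (rule integral_unique)
    qed
    ultimately show ?thesis by simp
  qed

  have "\<exists>m c. c > 0 \<and> (\<forall>r. 0 < r \<and> r \<le> r0 \<longrightarrow> c * r ^ m \<le> h r)"
  proof (rule frequency_lower_bound[where h' = h' and Q = Q and Q' = Q' and A = "2 * C" and B = "C\<^sup>2 / 2",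
          OF hD QD _ _ _ r0(1,2)])
    fix r assume r: "0 < r" "r < R"
    show "0 \<le> h r" by (rule has_integral_nonneg[OF hI[OF r]]) simp
    show "h' r \<le> 2 / r * Q r + 2 * C * h r"
    proof (rule has_integral_le[OF h'I[OF r]])
      show "((\<lambda>t. 2 / r * (- (V r t \<bullet> J (Vt r t))) + 2 * C * (V r t \<bullet> V r t)) has_integral
          2 / r * Q r + 2 * C * h r) ?I"
        by (intro has_integral_add has_integral_mult_right hI QI r)
      fix t
      let ?F = "Vr r t + (1 / r) *\<^sub>R J (Vt r t)"
      have "V r t \<bullet> ?F \<le> norm (V r t) * norm ?F" by (rule norm_cauchy_schwarz)
      also have "\<dots> \<le> norm (V r t) * (C * norm (V r t))"
        by (intro mult_left_mono CR r) simp
      finally have "V r t \<bullet> ?F \<le> C * (V r t \<bullet> V r t)"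
        by (simp add: dot_square_norm power2_eq_square mult_ac)
      then show "2 * (V r t \<bullet> Vr r t) \<le> 2 / r * (- (V r t \<bullet> J (Vt r t))) + 2 * C * (V r t \<bullet> V r t)"
        by (simp add: inner_add_right)
    qed
  next
    fix r q assume r: "0 < r" "r < R" and q: "Q r = q * h r"
    \<comment> \<open>The term \<open>V \<bullet> P\<close> need not vanish pointwise, but it integrates to \<open>Q r - q * h r = 0\<close>.\<close>
    have lower: "((\<lambda>t. 2 * q / r * (- (V r t \<bullet> J (Vt r t)) - q * (V r t \<bullet> V r t))
          - C\<^sup>2 / 2 * r * (V r t \<bullet> V r t)) has_integral
        2 * q / r * (Q r - q * h r) - C\<^sup>2 / 2 * r * h r) ?I"
      by (intro has_integral_diff has_integral_mult_right hI QI r)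
    have "2 * q / r * (Q r - q * h r) - C\<^sup>2 / 2 * r * h r \<le> Q' r - q * h' r"
    proof (rule has_integral_le[OF lower has_integral_diff[OF Q'I[OF r] has_integral_mult_right[OF h'I[OF r]]]])
      fix t
      define F where "F = Vr r t + (1 / r) *\<^sub>R J (Vt r t)"
      define P where "P = - J (Vt r t) - q *\<^sub>R V r t"
      have vr: "Vr r t = F + (1 / r) *\<^sub>R (P + q *\<^sub>R V r t)"
        by (simp add: F_def P_def)
      have "norm F ^ 2 \<le> (C * norm (V r t))\<^sup>2"
        unfolding F_def by (rule power_mono[OF CR[OF r]]) simp
      then have F: "F \<bullet> F \<le> C\<^sup>2 * (V r t \<bullet> V r t)"
        by (simp add: dot_square_norm power_mult_distrib)
      have "0 \<le> 2 / r * ((P + (r / 2) *\<^sub>R F) \<bullet> (P + (r / 2) *\<^sub>R F))"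
        using r by simp
      also have "\<dots> = 2 / r * (P \<bullet> P) + 2 * (F \<bullet> P) + r / 2 * (F \<bullet> F)"
        using r by (simp add: inner_add_left inner_add_right inner_commute field_simps power2_eq_square)
      finally have "- (r / 2 * (F \<bullet> F)) \<le> 2 / r * (P \<bullet> P) + 2 * (F \<bullet> P)" by simp
      moreover have "r / 2 * (F \<bullet> F) \<le> C\<^sup>2 / 2 * r * (V r t \<bullet> V r t)"
        using mult_left_mono[OF F, of "r / 2"] r by (simp add: mult_ac)
      ultimately have "- (C\<^sup>2 / 2 * r * (V r t \<bullet> V r t)) \<le> 2 / r * (P \<bullet> P) + 2 * (F \<bullet> P)"
        by linarith
      also have "\<dots> = 2 * (Vr r t \<bullet> P) - 2 * q / r * (V r t \<bullet> P)"
        by (simp add: vr inner_add_left algebra_simps)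
      finally have "2 * q / r * (V r t \<bullet> P) - C\<^sup>2 / 2 * r * (V r t \<bullet> V r t) \<le> 2 * (Vr r t \<bullet> P)" by simp
      then show "2 * q / r * (- (V r t \<bullet> J (Vt r t)) - q * (V r t \<bullet> V r t)) - C\<^sup>2 / 2 * r * (V r t \<bullet> V r t)
          \<le> - 2 * (Vr r t \<bullet> J (Vt r t)) - q * (2 * (V r t \<bullet> Vr r t))"
        by (simp add: P_def inner_diff_right inner_commute algebra_simps)
    qed
    then show "- (C\<^sup>2 / 2 * r * h r) \<le> Q' r - q * h' r" by (simp add: q)
  next
    have "h r0 \<noteq> 0"
    proof
      assume "h r0 = 0"
      then have "\<forall>t\<in>?I. V r0 t \<bullet> V r0 t = 0"
        unfolding h_def using r0 by (subst (asm) integral_eq_0_iff) (auto intro!: continuous_intros)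
      then show False using r0 by auto
    qed
    moreover have "0 \<le> h r0" by (rule has_integral_nonneg[OF hI]) (use r0 in auto)
    ultimately show "0 < h r0" by simp
  qed
  then show ?thesis by (simp add: h_def)
qed

lemma norm_rotate:
  fixes J :: "'e::real_inner \<Rightarrow> 'e"
  assumes JJ: "\<And>x. J (J x) = - x" and skew: "\<And>x y. J x \<bullet> y = - (x \<bullet> J y)"
  shows "norm (cos t *\<^sub>R a - sin t *\<^sub>R J a) = norm a"
proof -
  have "a \<bullet> J a = 0" using skew[of a a] by (simp add: inner_commute)
  moreover have "J a \<bullet> J a = a \<bullet> a" using skew[of a "J a"] by (simp add: JJ)
  ultimately have "(cos t *\<^sub>R a - sin t *\<^sub>R J a) \<bullet> (cos t *\<^sub>R a - sin t *\<^sub>R J a)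
      = ((cos t)\<^sup>2 + (sin t)\<^sup>2) * (a \<bullet> a)"
    by (simp add: inner_diff_left inner_diff_right inner_commute[of "J a" a] power2_eq_square
        algebra_simps del: sin_cos_squared_add sin_cos_squared_add2 sin_cos_squared_add3)
  then show ?thesis by (simp add: norm_eq_sqrt_inner)
qed

text \<open>In polar coordinates \<open>W\<^sub>1 + J W\<^sub>2\<close> becomes \<open>V\<^sub>r + J V\<^sub>t / r\<close> up to the rotation \<open>cos t - sin t J\<close>,
  which is isometric. If \<open>W\<close> were nonzero at distance \<open>r0\<close> from \<open>p\<close>, its \<open>L\<^sup>2\<close> norm on small circles
  would be bounded below by a multiple of a power of the radius, against the vanishing to infinite
  order. Since the lower bound starts from any radius \<open>r0 < R\<close>, the conclusion holds in the whole
  ball, whatever the size of \<open>C * R\<close>.\<close>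

theorem cauchy_riemann_strong_unique_continuation:
  fixes W :: "real ^ 2 \<Rightarrow> 'e::euclidean_space" and J :: "'e \<Rightarrow> 'e"
  assumes J: "linear J" and JJ: "\<And>x. J (J x) = - x" and skew: "\<And>x y. J x \<bullet> y = - (x \<bullet> J y)"
    and W: "smooth_on (ball p R) W"
    and ineq: "\<And>x. x \<in> ball p R \<Longrightarrow>
      norm (partial_deriv 1 W x + J (partial_deriv 2 W x)) \<le> C * norm (W x)"
    and flat: "\<And>N::nat. \<exists>K. \<forall>\<^sub>F x in nhds p. norm (W x) \<le> K * norm (x - p) ^ N"
    and x: "x \<in> ball p R"
  shows "W x = 0"
proof (rule ccontr)
  assume Wx: "W x \<noteq> 0"
  have J': "bounded_linear J" using J by (simp add: linear_conv_bounded_linear)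
  have J_simps: "J (a + b) = J a + J b" "J (a - b) = J a - J b" "J (c *\<^sub>R a) = c *\<^sub>R J a" for a b c
    using J by (simp_all add: linear_add linear_diff linear_cmul)
  let ?W1 = "partial_deriv 1 W" and ?W2 = "partial_deriv 2 W"
  let ?W11 = "partial_deriv 1 ?W1" and ?W12 = "partial_deriv 1 ?W2" and ?W22 = "partial_deriv 2 ?W2"
  have sm: "smooth_on (ball p R) (partial_deriv i W)"
    "smooth_on (ball p R) (partial_deriv j (partial_deriv i W))" for i j
    using smooth_on_partial_deriv W open_ball by blast+
  have swap: "partial_deriv 2 ?W1 y = ?W12 y" if "y \<in> ball p R" for y
    using mixed_partials_commute[OF open_ball W that] by simp
  define e where "e = (\<lambda>t. cos t *\<^sub>R axis 1 1 + sin t *\<^sub>R axis 2 1 :: real ^ 2)"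
  define e' where "e' = (\<lambda>t. (- sin t) *\<^sub>R axis 1 1 + cos t *\<^sub>R axis 2 1 :: real ^ 2)"
  define z where "z = (\<lambda>r t. p + r *\<^sub>R e t)"
  have e_nth: "e t $ 1 = cos t" "e t $ 2 = sin t" "e' t $ 1 = - sin t" "e' t $ 2 = cos t" for t
    by (simp_all add: e_def e'_def axis_def)
  have norm_e: "norm (e t) = 1" for t
    by (simp add: norm_eq_1 inner_vec_def sum_2 e_nth flip: power2_eq_square)
  have zB: "z r t \<in> ball p R" if "0 < r" "r < R" for r t
    using that norm_e by (simp add: z_def dist_norm)
  have z_2pi: "z r (2 * pi) = z r 0" for r by (simp add: z_def e_def)
  have z_r: "((\<lambda>r. z r t) has_vector_derivative e t) (at r)" for r t
    unfolding z_def by (auto intro!: derivative_eq_intros)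
  have e_t: "(e has_vector_derivative e' t) (at t)" for t
    unfolding e_def e'_def
    by (auto intro!: derivative_eq_intros simp: has_real_derivative_iff_has_vector_derivative[symmetric])
  have z_t: "((\<lambda>t. z r t) has_vector_derivative r *\<^sub>R e' t) (at t)" for r t
    unfolding z_def by (auto intro!: derivative_eq_intros e_t)
  have D_r: "((\<lambda>r. f (z r t)) has_vector_derivative
      cos t *\<^sub>R partial_deriv 1 f (z r t) + sin t *\<^sub>R partial_deriv 2 f (z r t)) (at r)"
    if "smooth_on (ball p R) f" "0 < r" "r < R" for f :: "real ^ 2 \<Rightarrow> 'e" and r t
    using has_vector_derivative_along_curve[OF that(1) zB[OF that(2,3)] z_r] by (simp add: e_nth)
  have D_t: "((\<lambda>t. f (z r t)) has_vector_derivative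
      (- r * sin t) *\<^sub>R partial_deriv 1 f (z r t) + (r * cos t) *\<^sub>R partial_deriv 2 f (z r t)) (at t)"
    if "smooth_on (ball p R) f" "0 < r" "r < R" for f :: "real ^ 2 \<Rightarrow> 'e" and r t
    using has_vector_derivative_along_curve[OF that(1) zB[OF that(2,3)] z_t] by (simp add: e_nth)
  have cont: "continuous_on ({0<..<R} \<times> UNIV) (\<lambda>x. f (z (fst x) (snd x)))"
    if "smooth_on (ball p R) f" for f :: "real ^ 2 \<Rightarrow> 'e"
    by (rule continuous_on_compose2[OF smooth_on_imp_continuous_on[OF that]])
       (use zB in \<open>auto simp: z_def e_def intro!: continuous_intros\<close>)
  note cI[continuous_intros] = cont[OF W] cont[OF sm(1)] cont[OF sm(2)]

  define r0 where "r0 = dist p x"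
  have "W p = 0"
    using flat[of 1] eventually_nhds_x_imp_x by fastforce
  then have "x \<noteq> p" using Wx by auto
  then have r0: "0 < r0" "r0 < R" using x by (auto simp: r0_def)
  have "((x - p) $ 1 / r0)\<^sup>2 + ((x - p) $ 2 / r0)\<^sup>2 = 1"
  proof -
    have "r0\<^sup>2 = ((x - p) $ 1)\<^sup>2 + ((x - p) $ 2)\<^sup>2"
      by (simp add: r0_def dist_commute[of p] dist_norm power2_norm_eq_inner inner_vec_def sum_2
          power2_commute[of "p $ _"] flip: power2_eq_square)
    then have "(((x - p) $ 1)\<^sup>2 + ((x - p) $ 2)\<^sup>2) / r0\<^sup>2 = 1" using r0 by auto
    then show ?thesis by (simp only: power_divide add_divide_distrib)
  qed
  then obtain t0 where t0: "0 \<le> t0" "t0 < 2 * pi" "(x - p) $ 1 / r0 = cos t0" "(x - p) $ 2 / r0 = sin t0"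
    using sincos_total_2pi by metis
  have "z r0 t0 = x"
    using t0(3,4) r0 by (simp add: z_def vec_eq_iff forall_2 e_nth field_simps)

  have "\<exists>m c. c > 0 \<and> (\<forall>r. 0 < r \<and> r \<le> r0 \<longrightarrow>
      c * r ^ m \<le> integral {0..2 * pi} (\<lambda>t. W (z r t) \<bullet> W (z r t)))"
  proof (rule circle_energy_lower_bound[OF J' skew, where V = "\<lambda>r t. W (z r t)"
        and Vr = "\<lambda>r t. cos t *\<^sub>R ?W1 (z r t) + sin t *\<^sub>R ?W2 (z r t)"
        and Vt = "\<lambda>r t. (- r * sin t) *\<^sub>R ?W1 (z r t) + (r * cos t) *\<^sub>R ?W2 (z r t)"
        and Vrt = "\<lambda>r t. (- sin t) *\<^sub>R ?W1 (z r t) + cos t *\<^sub>R ?W2 (z r t)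
          + (- r * sin t * cos t) *\<^sub>R ?W11 (z r t) + (r * (cos t * cos t - sin t * sin t)) *\<^sub>R ?W12 (z r t)
          + (r * sin t * cos t) *\<^sub>R ?W22 (z r t)" and R = R and C = C and s = t0])
    fix r t assume r: "0 < r" "r < R"
    show "((\<lambda>r. W (z r t)) has_vector_derivative cos t *\<^sub>R ?W1 (z r t) + sin t *\<^sub>R ?W2 (z r t)) (at r)"
      by (rule D_r[OF W r])
    show "((\<lambda>t. W (z r t)) has_vector_derivative
        (- r * sin t) *\<^sub>R ?W1 (z r t) + (r * cos t) *\<^sub>R ?W2 (z r t)) (at t)"
      by (rule D_t[OF W r])
    show "((\<lambda>r. (- r * sin t) *\<^sub>R ?W1 (z r t) + (r * cos t) *\<^sub>R ?W2 (z r t)) has_vector_derivative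
        (- sin t) *\<^sub>R ?W1 (z r t) + cos t *\<^sub>R ?W2 (z r t)
          + (- r * sin t * cos t) *\<^sub>R ?W11 (z r t) + (r * (cos t * cos t - sin t * sin t)) *\<^sub>R ?W12 (z r t)
          + (r * sin t * cos t) *\<^sub>R ?W22 (z r t)) (at r)"
      by (rule derivative_eq_intros D_r sm r refl)+
         (simp add: swap[OF zB[OF r]] algebra_simps scaleR_add_left)
    show "((\<lambda>t. cos t *\<^sub>R ?W1 (z r t) + sin t *\<^sub>R ?W2 (z r t)) has_vector_derivative
        (- sin t) *\<^sub>R ?W1 (z r t) + cos t *\<^sub>R ?W2 (z r t)
          + (- r * sin t * cos t) *\<^sub>R ?W11 (z r t) + (r * (cos t * cos t - sin t * sin t)) *\<^sub>R ?W12 (z r t)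
          + (r * sin t * cos t) *\<^sub>R ?W22 (z r t)) (at t)"
      by (rule derivative_eq_intros D_t sm r refl)+
         (simp add: swap[OF zB[OF r]] algebra_simps scaleR_add_left)
    let ?G = "?W1 (z r t) + J (?W2 (z r t))"
    have "(cos t *\<^sub>R ?W1 (z r t) + sin t *\<^sub>R ?W2 (z r t)) + (1 / r) *\<^sub>R
        J ((- r * sin t) *\<^sub>R ?W1 (z r t) + (r * cos t) *\<^sub>R ?W2 (z r t))
        = cos t *\<^sub>R ?G - sin t *\<^sub>R J ?G"
      using r by (simp add: J_simps JJ scaleR_add_right algebra_simps)
    moreover have "norm (cos t *\<^sub>R ?G - sin t *\<^sub>R J ?G) = norm ?G"
      by (rule norm_rotate[OF JJ skew])
    ultimately show "norm ((cos t *\<^sub>R ?W1 (z r t) + sin t *\<^sub>R ?W2 (z r t)) + (1 / r) *\<^sub>R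
        J ((- r * sin t) *\<^sub>R ?W1 (z r t) + (r * cos t) *\<^sub>R ?W2 (z r t))) \<le> C * norm (W (z r t))"
      using ineq[OF zB[OF r]] by simp
  next
    show "W (z r0 t0) \<noteq> 0" using Wx \<open>z r0 t0 = x\<close> by simp
  qed (use r0 t0 z_2pi in \<open>auto intro!: continuous_intros\<close>)
  then obtain m c where c: "c > 0"
    and lower: "\<And>r. 0 < r \<Longrightarrow> r \<le> r0 \<Longrightarrow> c * r ^ m \<le> integral {0..2 * pi} (\<lambda>t. W (z r t) \<bullet> W (z r t))"
    by blast
  obtain K where "\<forall>\<^sub>F x in nhds p. norm (W x) \<le> K * norm (x - p) ^ (m + 1)" using flat by blast
  then obtain d where d: "d > 0" "\<And>y. dist y p < d \<Longrightarrow> norm (W y) \<le> K * norm (y - p) ^ (m + 1)"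
    unfolding eventually_nhds_metric by blast
  have upper: "c \<le> 2 * pi * K\<^sup>2 * r ^ (m + 2)" if r: "0 < r" "r \<le> r0" "r < d" for r
  proof -
    have "W (z r t) \<bullet> W (z r t) \<le> K\<^sup>2 * r ^ (m + 2) * r ^ m" for t
    proof -
      have "norm (W (z r t)) \<le> K * r ^ (m + 1)"
        using d(2)[of "z r t"] r by (simp add: z_def dist_norm norm_e)
      then have "(norm (W (z r t)))\<^sup>2 \<le> (K * r ^ (m + 1))\<^sup>2" by (rule power_mono) simp
      then show ?thesis
        by (simp add: dot_square_norm power_mult_distrib power_add power2_eq_square mult_ac)
    qed
    then have "integral {0..2 * pi} (\<lambda>t. W (z r t) \<bullet> W (z r t))
        \<le> integral {0..2 * pi} (\<lambda>t. K\<^sup>2 * r ^ (m + 2) * r ^ m)"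
      using r r0 by (intro integral_le integrable_continuous_real continuous_intros
          continuous_on_compose2[OF cont[OF W], of _ "\<lambda>t. (r, t)", simplified]) auto
    then have "c * r ^ m \<le> (2 * pi * K\<^sup>2 * r ^ (m + 2)) * r ^ m"
      using lower[OF r(1,2)] by (simp add: mult_ac)
    then show ?thesis using r by simp
  qed
  have "((\<lambda>r. 2 * pi * K\<^sup>2 * r ^ (m + 2)) \<longlongrightarrow> 2 * pi * K\<^sup>2 * 0 ^ (m + 2)) (at_right 0)"
    by (intro tendsto_intros)
  moreover have "\<forall>\<^sub>F r in at_right 0. c \<le> 2 * pi * K\<^sup>2 * r ^ (m + 2)"
    unfolding eventually_at_right_field using d(1) r0(1) upper
    by (intro exI[of _ "min d r0"]) auto
  ultimately have "c \<le> 2 * pi * K\<^sup>2 * 0 ^ (m + 2)"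
    by (rule tendsto_lowerbound) simp
  then show False using c by simp
qed

section \<open>Vanishing to infinite order\<close>

text \<open>The unique continuation argument is restarted at points other than the origin, so vanishing to
  infinite order is needed at an arbitrary point.\<close>

definition flat_at :: "'a::real_normed_vector \<Rightarrow> ('a \<Rightarrow> 'b::real_normed_vector) \<Rightarrow> bool"
  where "flat_at p f \<longleftrightarrow>
    (\<forall>N::nat. \<exists>K::real. \<forall>\<^sub>F x in nhds p. norm (f x) \<le> K * norm (x - p) ^ N)"

lemma flat_at_0_iff: "flat_at 0 f \<longleftrightarrow> vanishes_to_infinite_order_at_0 f"
  unfolding flat_at_def vanishes_to_infinite_order_at_0_def by simp

lemma flat_at_bounded_linear:
  assumes "bounded_linear L" "flat_at p f"
  shows "flat_at p (\<lambda>x. L (f x))"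
  unfolding flat_at_def
proof
  fix N
  obtain B where B: "B > 0" "\<And>x. norm (L x) \<le> norm x * B"
    using bounded_linear.pos_bounded[OF assms(1)] by blast
  obtain K where "\<forall>\<^sub>F x in nhds p. norm (f x) \<le> K * norm (x - p) ^ N"
    using assms(2) unfolding flat_at_def by blast
  then have "\<forall>\<^sub>F x in nhds p. norm (L (f x)) \<le> B * K * norm (x - p) ^ N"
  proof (rule eventually_mono)
    fix x assume "norm (f x) \<le> K * norm (x - p) ^ N"
    then have "norm (f x) * B \<le> K * norm (x - p) ^ N * B" using B(1) by (intro mult_right_mono) auto
    then show "norm (L (f x)) \<le> B * K * norm (x - p) ^ N" using B(2)[of "f x"] by (simp add: mult_ac)
  qed
  then show "\<exists>K. \<forall>\<^sub>F x in nhds p. norm (L (f x)) \<le> K * norm (x - p) ^ N" by blast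
qed

lemma flat_at_Pair:
  assumes "flat_at p f" "flat_at p g"
  shows "flat_at p (\<lambda>x. (f x, g x))"
  unfolding flat_at_def
proof
  fix N
  obtain K L where "\<forall>\<^sub>F x in nhds p. norm (f x) \<le> K * norm (x - p) ^ N"
    "\<forall>\<^sub>F x in nhds p. norm (g x) \<le> L * norm (x - p) ^ N"
    using assms unfolding flat_at_def by blast
  then have "\<forall>\<^sub>F x in nhds p. norm (f x, g x) \<le> (K + L) * norm (x - p) ^ N"
  proof eventually_elim
    case (elim x)
    then show ?case using norm_Pair_le[of "f x" "g x"] by (simp add: distrib_right)
  qed
  then show "\<exists>K. \<forall>\<^sub>F x in nhds p. norm (f x, g x) \<le> K * norm (x - p) ^ N" by blast
qed

lemma first_order_taylor_bound:
  fixes f :: "real ^ 2 \<Rightarrow> 'b::real_normed_vector"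
  assumes f: "smooth_on S f" "open S" and h: "0 < h"
    and seg: "\<And>t. 0 \<le> t \<Longrightarrow> t \<le> h \<Longrightarrow> x + t *\<^sub>R axis i 1 \<in> S"
    and M: "\<And>t. 0 \<le> t \<Longrightarrow> t \<le> h \<Longrightarrow>
      norm (partial_deriv i (partial_deriv i f) (x + t *\<^sub>R axis i 1)) \<le> M"
  shows "norm (f (x + h *\<^sub>R axis i 1) - f x - h *\<^sub>R partial_deriv i f x) \<le> h * (M * h)"
proof -
  define c where "c = (\<lambda>t. x + t *\<^sub>R axis i (1::real))"
  have D: "((\<lambda>t. g (c t)) has_vector_derivative partial_deriv i g (c t)) (at t within {0..h})"
    if "smooth_on S g" "t \<in> {0..h}" for g :: "real ^ 2 \<Rightarrow> 'b" and t
  proof -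
    have "(g has_derivative frechet_derivative g (at (c t))) (at (c t))"
      using smooth_on_imp_differentiable[OF that(1)] seg that(2) frechet_derivative_works
      by (auto simp: c_def)
    moreover have "(c has_derivative (\<lambda>s. s *\<^sub>R axis i 1)) (at t)"
      unfolding c_def by (auto intro!: derivative_eq_intros)
    ultimately have "((\<lambda>t. g (c t)) has_derivative
        (\<lambda>s. frechet_derivative g (at (c t)) (s *\<^sub>R axis i 1))) (at t)"
      using has_derivative_compose by blast
    moreover have "g differentiable at (c t)"
      using smooth_on_imp_differentiable[OF that(1)] seg that(2) by (auto simp: c_def)
    ultimately show ?thesis
      by (simp add: has_vector_derivative_def partial_deriv_eq_frechet_derivative
          linear_cmul[OF linear_frechet_derivative] has_derivative_at_withinI)
  qed
  have grad: "norm (partial_deriv i f (c t) - partial_deriv i f (c 0)) \<le> M * h" if t: "t \<in> {0..h}" for t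
  proof -
    have "norm (partial_deriv i f (c t) - partial_deriv i f (c 0)) \<le> M * norm (t - 0)"
    proof (rule differentiable_bound[where S = "{0..h}"])
      show "((\<lambda>t. partial_deriv i f (c t)) has_derivative
          (\<lambda>s. s *\<^sub>R partial_deriv i (partial_deriv i f) (c s'))) (at s' within {0..h})"
        if "s' \<in> {0..h}" for s'
        using D[OF smooth_on_partial_deriv[OF f(2,1)] that] by (simp add: has_vector_derivative_def)
      show "onorm (\<lambda>s. s *\<^sub>R partial_deriv i (partial_deriv i f) (c s')) \<le> M"
        if "s' \<in> {0..h}" for s'
        using M[of s'] that
        by (intro onorm_le) (auto simp: c_def mult.commute[of M] intro!: mult_left_mono)
    qed (use t h in auto)
    also have "\<dots> \<le> M * h"
    proof (rule mult_left_mono)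
      have "norm (partial_deriv i (partial_deriv i f) (c 0)) \<le> M" using M[of 0] h by (simp add: c_def)
      then show "0 \<le> M" using norm_ge_zero order_trans by blast
    qed (use t in auto)
    finally show ?thesis .
  qed
  have "norm (f (c h) - f (c 0) - (h - 0) *\<^sub>R partial_deriv i f (c 0)) \<le> norm (h - 0) * (M * h)"
    by (rule vector_differentiable_bound_linearization[where S = "{0..h}"])
       (use D[OF f(1)] grad h in \<open>auto simp: closed_segment_eq_real_ivl\<close>)
  then show ?thesis using h by (simp add: c_def)
qed

text \<open>An interpolation argument: the first derivative is controlled by \<open>\<bar>f\<bar> / h + M * h\<close>, where \<open>M\<close> bounds
  the second derivative. At distance \<open>\<rho>\<close> from \<open>p\<close> the choice \<open>h = \<rho> ^ (N + 1)\<close> balances the two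
  terms, as \<open>f\<close> is of order \<open>\<rho> ^ (2 * (N + 1)) = h\<^sup>2\<close>. The estimate at \<open>p\<close> itself, where \<open>h\<close> would
  be zero, follows by continuity.\<close>

lemma flat_at_partial_deriv:
  fixes f :: "real ^ 2 \<Rightarrow> 'b::real_normed_vector"
  assumes f: "smooth_on S f" "open S" "p \<in> S" and flat: "flat_at p f"
  shows "flat_at p (partial_deriv i f)"
  unfolding flat_at_def
proof
  fix N :: nat
  have sm: "smooth_on S (partial_deriv i f)" "smooth_on S (partial_deriv i (partial_deriv i f))"
    using smooth_on_partial_deriv f by blast+
  obtain r where r: "r > 0" "cball p r \<subseteq> S"
    using f open_contains_cball by blast
  have "bounded (partial_deriv i (partial_deriv i f) ` cball p r)"
    by (intro compact_imp_bounded compact_continuous_image compact_cball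
        continuous_on_subset[OF smooth_on_imp_continuous_on[OF sm(2)] r(2)])
  then obtain M where M: "\<And>y. y \<in> cball p r \<Longrightarrow> norm (partial_deriv i (partial_deriv i f) y) \<le> M"
    unfolding bounded_iff by blast
  obtain K where "\<forall>\<^sub>F x in nhds p. norm (f x) \<le> K * norm (x - p) ^ (2 * (N + 1))"
    using flat unfolding flat_at_def by blast
  then obtain d where d: "d > 0" and K: "\<And>y. dist y p < d \<Longrightarrow> norm (f y) \<le> K * norm (y - p) ^ (2 * (N + 1))"
    unfolding eventually_nhds_metric by blast
  \<comment> \<open>With this \<open>\<delta>\<close>, the segment of length \<open>h \<le> \<rho>\<close> starting at \<open>x\<close> stays within distance \<open>2 * \<rho> < min r d\<close> of \<open>p\<close>.\<close>
  define \<delta> where "\<delta> = min 1 (min r d / 2)"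
  define B where "B = \<bar>M\<bar> + \<bar>K\<bar> * (2 ^ (2 * (N + 1)) + 1)"
  have \<delta>: "\<delta> > 0" using r d by (simp add: \<delta>_def)
  have punctured: "norm (partial_deriv i f x) \<le> B * norm (x - p) ^ N" if x: "x \<noteq> p" "dist x p < \<delta>" for x
  proof -
    define \<rho> where "\<rho> = norm (x - p)"
    define h where "h = \<rho> ^ (N + 1)"
    have \<rho>: "0 < \<rho>" "\<rho> \<le> 1" "2 * \<rho> < r" "2 * \<rho> < d"
      using x by (auto simp: \<rho>_def \<delta>_def dist_norm)
    have h: "0 < h" "h \<le> \<rho>" using \<rho> by (auto simp: h_def mult_left_le power_le_one)
    have dist: "norm (x + t *\<^sub>R axis i 1 - p) \<le> 2 * \<rho>" if "0 \<le> t" "t \<le> h" for t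
    proof -
      have "norm (x + t *\<^sub>R axis i 1 - p) \<le> norm (x - p) + norm (t *\<^sub>R axis i (1::real) :: real ^ 2)"
        by (metis add.commute add_diff_eq norm_triangle_ineq)
      then show ?thesis using that h by (simp add: \<rho>_def)
    qed
    have in_ball: "x + t *\<^sub>R axis i 1 \<in> cball p r" if "0 \<le> t" "t \<le> h" for t
      using dist[OF that] \<rho>(3) by (simp add: dist_norm norm_minus_commute)
    have "norm (f (x + h *\<^sub>R axis i 1) - f x - h *\<^sub>R partial_deriv i f x) \<le> h * (M * h)"
      by (rule first_order_taylor_bound[OF f(1,2) h(1)]) (use in_ball r M in auto)
    moreover have "norm (f (x + h *\<^sub>R axis i 1)) \<le> \<bar>K\<bar> * 2 ^ (2 * (N + 1)) * h\<^sup>2"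
    proof -
      have "norm (f (x + h *\<^sub>R axis i 1)) \<le> K * norm (x + h *\<^sub>R axis i 1 - p) ^ (2 * (N + 1))"
        using dist[of h] h \<rho>(4) by (intro K) (simp add: dist_norm)
      also have "\<dots> \<le> \<bar>K\<bar> * (2 * \<rho>) ^ (2 * (N + 1))"
        by (intro mult_mono power_mono dist) (use h in auto)
      also have "\<dots> = \<bar>K\<bar> * 2 ^ (2 * (N + 1)) * h\<^sup>2"
        by (simp only: h_def power_mult_distrib power_mult[symmetric] mult.assoc mult.commute[of "N + 1" 2])
      finally show ?thesis .
    qed
    moreover have "norm (f x) \<le> \<bar>K\<bar> * h\<^sup>2"
    proof -
      have "norm (f x) \<le> K * \<rho> ^ (2 * (N + 1))"
        unfolding \<rho>_def by (intro K) (use \<rho>(1,4) in \<open>simp add: \<rho>_def dist_norm del: zero_less_norm_iff\<close>)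
      also have "\<dots> \<le> \<bar>K\<bar> * \<rho> ^ (2 * (N + 1))" using \<rho> by (intro mult_right_mono) auto
      also have "\<dots> = \<bar>K\<bar> * h\<^sup>2"
        by (simp only: h_def power_mult[symmetric] mult.commute[of "N + 1" 2])
      finally show ?thesis .
    qed
    moreover have "norm (h *\<^sub>R partial_deriv i f x) \<le>
        norm (f (x + h *\<^sub>R axis i 1) - f x - h *\<^sub>R partial_deriv i f x) + norm (f (x + h *\<^sub>R axis i 1)) + norm (f x)"
      using norm_triangle_ineq4[of "f (x + h *\<^sub>R axis i 1) - f x" "f (x + h *\<^sub>R axis i 1) - f x - h *\<^sub>R partial_deriv i f x"]
        norm_triangle_ineq4[of "f (x + h *\<^sub>R axis i 1)" "f x"] by simp
    moreover have "h * (M * h) \<le> \<bar>M\<bar> * h\<^sup>2"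
      using h by (simp add: power2_eq_square mult.left_commute mult_right_mono)
    ultimately have "norm (h *\<^sub>R partial_deriv i f x) \<le>
        \<bar>M\<bar> * h\<^sup>2 + \<bar>K\<bar> * 2 ^ (2 * (N + 1)) * h\<^sup>2 + \<bar>K\<bar> * h\<^sup>2" by linarith
    also have "\<dots> = B * h\<^sup>2" by (simp add: B_def algebra_simps)
    finally have "h * norm (partial_deriv i f x) \<le> h * (B * h)"
      using h(1) by (simp add: power2_eq_square mult_ac)
    then have "norm (partial_deriv i f x) \<le> B * h" using h(1) by simp
    also have "\<dots> \<le> B * \<rho> ^ N"
      using \<rho> by (intro mult_left_mono) (auto simp: h_def B_def mult_left_le_one_le)
    finally show ?thesis by (simp add: \<rho>_def)
  qed
  have "norm (partial_deriv i f p) \<le> B * norm (p - p) ^ N"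
  proof (rule tendsto_le[of "at p"])
    have "isCont (partial_deriv i f) p"
      using smooth_on_imp_continuous_on[OF sm(1)] f continuous_on_eq_continuous_at by blast
    then show "((\<lambda>x. norm (partial_deriv i f x)) \<longlongrightarrow> norm (partial_deriv i f p)) (at p)"
      unfolding isCont_def by (rule tendsto_norm)
    show "((\<lambda>x. B * norm (x - p) ^ N) \<longlongrightarrow> B * norm (p - p) ^ N) (at p)"
      by (intro tendsto_intros)
    show "\<forall>\<^sub>F x in at p. norm (partial_deriv i f x) \<le> B * norm (x - p) ^ N"
      unfolding eventually_at using \<delta> punctured by blast
  qed simp
  then have "norm (partial_deriv i f x) \<le> B * norm (x - p) ^ N" if "dist x p < \<delta>" for x
    using punctured that by (cases "x = p") auto
  then show "\<exists>K. \<forall>\<^sub>F x in nhds p. norm (partial_deriv i f x) \<le> K * norm (x - p) ^ N"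
    unfolding eventually_nhds_metric using \<delta> by blast
qed

section \<open>Reduction of the Laplacian to a Cauchy-Riemann system\<close>

lemma partial_deriv_bounded_linear:
  assumes "bounded_linear L" "f differentiable at x"
  shows "partial_deriv i (\<lambda>x. L (f x)) x = L (partial_deriv i f x)"
proof -
  have "((\<lambda>x. L (f x)) has_derivative (\<lambda>h. L (frechet_derivative f (at x) h))) (at x)"
    using assms frechet_derivative_works by (intro bounded_linear.has_derivative[OF assms(1)]) blast
  then show ?thesis
    using partial_deriv_at[of "\<lambda>x. L (f x)"] partial_deriv_eq_frechet_derivative[OF assms(2)] by simp
qed

lemma partial_deriv_Pair:
  assumes "f differentiable at x" "g differentiable at x"
  shows "partial_deriv i (\<lambda>x. (f x, g x)) x = (partial_deriv i f x, partial_deriv i g x)"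
proof -
  have "((\<lambda>x. (f x, g x)) has_derivative
      (\<lambda>h. (frechet_derivative f (at x) h, frechet_derivative g (at x) h))) (at x)"
    using assms by (intro has_derivative_Pair) (simp_all flip: frechet_derivative_works)
  then show ?thesis
    using partial_deriv_at[of "\<lambda>x. (f x, g x)"] partial_deriv_eq_frechet_derivative[OF assms(1)]
      partial_deriv_eq_frechet_derivative[OF assms(2)] by simp
qed

definition times_i :: "complex ^ 'n \<Rightarrow> complex ^ 'n"
  where "times_i v = (\<chi> j. \<i> * v $ j)"

lemma times_i_simps:
  "times_i (v + w) = times_i v + times_i w" "times_i (v - w) = times_i v - times_i w"
  "times_i (c *\<^sub>R v) = c *\<^sub>R times_i v" "times_i (- v) = - times_i v" "times_i (times_i v) = - v"
  "times_i v \<bullet> w = - (v \<bullet> times_i w)" "norm (times_i v) = norm v"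
  by (simp_all add: times_i_def vec_eq_iff algebra_simps inner_vec_def inner_complex_def
      norm_vec_def norm_mult flip: sum_negf)

text \<open>Applied to \<open>(u, u\<^sub>1, u\<^sub>2)\<close>, this is the triple \<open>(u, 2 \<partial> u, 2 \<partial>' u)\<close> with the Wirtinger
  derivatives \<open>\<partial> = (\<partial>\<^sub>1 - i \<partial>\<^sub>2) / 2\<close> and \<open>\<partial>' = (\<partial>\<^sub>1 + i \<partial>\<^sub>2) / 2\<close>.\<close>

definition cr_system :: "(complex ^ 'n) \<times> (complex ^ 'n) \<times> (complex ^ 'n)
    \<Rightarrow> ((complex ^ 'n) \<times> (complex ^ 'n)) \<times> (complex ^ 'n)"
  where "cr_system = (\<lambda>(v, a, b). ((v, a - times_i b), a + times_i b))"

text \<open>The complex structure is conjugated in the last component because it is \<open>\<partial>\<close>, not \<open>\<partial>'\<close>, that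
  takes \<open>\<partial>' u\<close> to a multiple of the Laplacian: \<open>4 \<partial>' \<partial> u = 4 \<partial> \<partial>' u = \<Delta> u\<close>.\<close>

definition cr_rotation :: "((complex ^ 'n) \<times> (complex ^ 'n)) \<times> (complex ^ 'n)
    \<Rightarrow> ((complex ^ 'n) \<times> (complex ^ 'n)) \<times> (complex ^ 'n)"
  where "cr_rotation = (\<lambda>((v, a), b). ((times_i v, times_i a), - times_i b))"

lemma bounded_linear_cr_system: "bounded_linear cr_system"
  unfolding linear_conv_bounded_linear[symmetric]
  by (rule linearI) (auto simp: cr_system_def times_i_simps algebra_simps)

lemma norm_le_cr_system:
  "norm v \<le> norm (cr_system (v, a, b))" "norm a \<le> norm (cr_system (v, a, b))"
  "norm b \<le> norm (cr_system (v, a, b))"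
proof -
  let ?W = "cr_system (v, a, b)"
  have fst: "norm (fst x) \<le> norm x" and snd: "norm (snd x) \<le> norm x"
    for x :: "'c::real_normed_vector \<times> 'd::real_normed_vector"
    by (metis norm_fst_le prod.collapse, metis norm_snd_le prod.collapse)
  show "norm v \<le> norm ?W"
    using fst[of "fst ?W"] fst[of ?W] by (simp add: cr_system_def)
  have minus: "norm (a - times_i b) \<le> norm ?W"
    using snd[of "fst ?W"] fst[of ?W] by (simp add: cr_system_def)
  have plus: "norm (a + times_i b) \<le> norm ?W"
    using snd[of ?W] by (simp add: cr_system_def)
  have "norm (2 *\<^sub>R a) \<le> norm (a - times_i b) + norm (a + times_i b)"
    using norm_triangle_ineq[of "a - times_i b" "a + times_i b"] by (simp add: scaleR_2)
  then show "norm a \<le> norm ?W" using minus plus by simp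
  have "norm (2 *\<^sub>R times_i b) \<le> norm (a + times_i b) + norm (a - times_i b)"
    using norm_triangle_ineq4[of "a + times_i b" "a - times_i b"] by (simp add: scaleR_2)
  then show "norm b \<le> norm ?W" using minus plus by (simp add: times_i_simps)
qed

text \<open>For \<open>W = (u, 2 \<partial> u, 2 \<partial>' u)\<close> the Cauchy-Riemann expression \<open>W\<^sub>1 + J W\<^sub>2\<close> equals
  \<open>(2 \<partial>' u, \<Delta> u, \<Delta> u)\<close>, which the differential inequality bounds by \<open>(2 + 6 * C) * \<bar>W\<bar>\<close>.\<close>

theorem laplace_strong_unique_continuation_ball:
  fixes u :: "real ^ 2 \<Rightarrow> complex ^ 'n"
  assumes u: "smooth_on (ball p R) u" and "C > 0"
    and ineq: "\<And>x. x \<in> ball p R \<Longrightarrow> norm (laplacian u x)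
           \<le> C * (norm (u x) + norm (partial_deriv 1 u x) + norm (partial_deriv 2 u x))"
    and flat: "flat_at p u" and x: "x \<in> ball p R"
  shows "u x = 0"
proof -
  let ?B = "ball p R"
  let ?u1 = "partial_deriv 1 u" and ?u2 = "partial_deriv 2 u"
  define U where "U = (\<lambda>x. (u x, ?u1 x, ?u2 x))"
  have sm: "smooth_on ?B (partial_deriv i u)" for i
    using smooth_on_partial_deriv u open_ball by blast
  have smU: "smooth_on ?B U"
    unfolding U_def by (intro smooth_on_Pair open_ball u sm)
  have p: "p \<in> ?B" using x by (auto intro: le_less_trans[OF zero_le_dist])
  have "cr_system (U x) = 0"
  proof (rule cauchy_riemann_strong_unique_continuation
      [where J = cr_rotation and W = "\<lambda>x. cr_system (U x)" and C = "2 + 6 * C", OF _ _ _ _ _ _ x])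
    show "linear (cr_rotation :: _ \<Rightarrow> ((complex ^ 'n) \<times> (complex ^ 'n)) \<times> (complex ^ 'n))"
      by (rule linearI) (auto simp: cr_rotation_def times_i_simps)
    show "cr_rotation (cr_rotation a) = - a" for a :: "((complex ^ 'n) \<times> (complex ^ 'n)) \<times> (complex ^ 'n)"
      by (auto simp: cr_rotation_def times_i_simps split: prod.split)
    show "cr_rotation a \<bullet> b = - (a \<bullet> cr_rotation b)"
      for a b :: "((complex ^ 'n) \<times> (complex ^ 'n)) \<times> (complex ^ 'n)"
      by (auto simp: cr_rotation_def times_i_simps split: prod.split)
    show "smooth_on ?B (\<lambda>x. cr_system (U x))"
      by (rule smooth_on_bounded_linear[OF bounded_linear_cr_system open_ball smU])
    have "flat_at p (\<lambda>x. cr_system (U x))"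
      unfolding U_def
      by (intro flat_at_bounded_linear[OF bounded_linear_cr_system] flat_at_Pair flat
          flat_at_partial_deriv[OF u open_ball p])
    then show "\<exists>K. \<forall>\<^sub>F x in nhds p. norm (cr_system (U x)) \<le> K * norm (x - p) ^ N" for N
      unfolding flat_at_def by blast
    fix y assume y: "y \<in> ?B"
    have dU: "partial_deriv i (\<lambda>x. cr_system (U x)) y =
        cr_system (partial_deriv i u y, partial_deriv i ?u1 y, partial_deriv i ?u2 y)" for i
      using y u sm[of 1] sm[of 2] smU
      by (simp add: partial_deriv_bounded_linear[OF bounded_linear_cr_system] U_def
          smooth_on_imp_differentiable[of ?B] partial_deriv_Pair)
    have "partial_deriv 1 (\<lambda>x. cr_system (U x)) y + cr_rotation (partial_deriv 2 (\<lambda>x. cr_system (U x)) y)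
        = ((?u1 y + times_i (?u2 y), laplacian u y), laplacian u y)"
      unfolding dU
      by (simp add: mixed_partials_commute[OF open_ball u y] cr_system_def cr_rotation_def
          laplacian_def times_i_simps)
    also have "norm \<dots> \<le> norm (?u1 y) + norm (?u2 y) + 2 * norm (laplacian u y)"
      using norm_Pair_le[of "(?u1 y + times_i (?u2 y), laplacian u y)" "laplacian u y"]
        norm_Pair_le[of "?u1 y + times_i (?u2 y)" "laplacian u y"]
        norm_triangle_ineq[of "?u1 y" "times_i (?u2 y)"] by (simp add: times_i_simps)
    also have "\<dots> \<le> norm (?u1 y) + norm (?u2 y) + 2 * (C * (norm (u y) + norm (?u1 y) + norm (?u2 y)))"
      using ineq[OF y] by simp
    also have "\<dots> \<le> norm (cr_system (U y)) + norm (cr_system (U y)) + 2 * (C *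
        (norm (cr_system (U y)) + norm (cr_system (U y)) + norm (cr_system (U y))))"
      unfolding U_def using \<open>C > 0\<close>
      by (intro add_mono mult_left_mono norm_le_cr_system) auto
    finally show "norm (partial_deriv 1 (\<lambda>x. cr_system (U x)) y
        + cr_rotation (partial_deriv 2 (\<lambda>x. cr_system (U x)) y)) \<le> (2 + 6 * C) * norm (cr_system (U y))"
      by (simp add: algebra_simps)
  qed
  then show ?thesis
    using norm_le_cr_system(1)[of "u x" "?u1 x" "?u2 x"] by (simp add: U_def)
qed

theorem theorem2:
  fixes X :: "(real ^ 2) set"
    and u :: "real ^ 2 \<Rightarrow> complex ^ 'n"
    and C :: real
  assumes "open X" and "connected X" and "0 \<in> X"
    and "smooth_on X u"
    and "C > 0"
    and "\<forall>x\<in>X. norm (laplacian u x)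
           \<le> C * (norm (u x) + norm (partial_deriv 1 u x) + norm (partial_deriv 2 u x))"
    and "vanishes_to_infinite_order_at_0 u"
  shows "\<forall>x\<in>X. u x = 0"
proof -
  define Z where "Z = interior {x \<in> X. u x = 0}"
  have ZX: "Z \<subseteq> X" and Z0: "\<And>x. x \<in> Z \<Longrightarrow> u x = 0"
    unfolding Z_def by (auto dest: subsetD[OF interior_subset])
  have ball_in_Z: "ball p r \<subseteq> Z" if "ball p r \<subseteq> X" "flat_at p u" for p r
  proof -
    have "u x = 0" if "x \<in> ball p r" for x
      by (rule laplace_strong_unique_continuation_ball[of p r, OF smooth_on_subset[OF assms(4)] assms(5)])
         (use assms(6) \<open>ball p r \<subseteq> X\<close> \<open>flat_at p u\<close> that in auto)
    then show ?thesis
      unfolding Z_def using that(1) by (intro interior_maximal) auto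
  qed
  have "Z \<noteq> {}"
  proof -
    obtain r where "r > 0" "ball 0 r \<subseteq> X" using assms openE by blast
    then show ?thesis
      using ball_in_Z[of 0 r] assms(7) by (auto simp: flat_at_0_iff)
  qed
  moreover have "openin (top_of_set X) Z"
    using ZX by (auto simp: Z_def intro: open_subset)
  \<comment> \<open>A limit point \<open>x\<close> of \<open>Z\<close> lies in a ball inside \<open>X\<close> about some \<open>q \<in> Z\<close>, and \<open>u\<close> is zero near \<open>q\<close>.\<close>
  moreover have "closedin (top_of_set X) Z"
    unfolding closedin_closed_eq closedin_limpt
  proof (intro conjI ZX allI impI)
    fix x assume x: "x islimpt Z \<and> x \<in> X"
    then obtain r where r: "r > 0" "ball x r \<subseteq> X" using assms openE by blast
    obtain q where q: "q \<in> Z" "dist q x < r / 2"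
      using x r unfolding islimpt_approachable by (metis half_gt_zero)
    have "ball q (r / 2) \<subseteq> ball x r"
    proof
      fix y assume "y \<in> ball q (r / 2)"
      then show "y \<in> ball x r"
        using q(2) dist_triangle[of x y q] by (simp add: dist_commute)
    qed
    moreover have "flat_at q u"
    proof -
      have "\<forall>\<^sub>F y in nhds q. y \<in> Z"
        using q(1) by (intro eventually_nhds_in_open) (auto simp: Z_def)
      then have "\<forall>\<^sub>F y in nhds q. norm (u y) \<le> 0 * norm (y - q) ^ N" for N :: nat
        by (rule eventually_mono) (simp add: Z0)
      then show ?thesis unfolding flat_at_def by blast
    qed
    ultimately have "ball q (r / 2) \<subseteq> Z" using ball_in_Z r(2) by blast
    moreover have "x \<in> ball q (r / 2)" using q(2) by simp
    ultimately show "x \<in> Z" by blast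
  qed
  ultimately have "Z = X"
    using \<open>connected X\<close> unfolding connected_clopen by blast
  then show ?thesis using Z0 by blast
qed

end
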